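(* Let $1\le k\le n$ be integers. Algorithm 1 (described in the context), which computes the partial exponential Bell polynomial $B_{n,k}(x)$ from $x_1,\ldots,x_n$, needs exactly $Q^{(1)}_{n,k}$ basic arithmetic operations, where $$Q^{(1)}_{n,k}=kn^2+2(-k^2+k+1)n+k^3-2k^2+2.$$
   Context: For a real sequence $x$, the partial exponential Bell polynomial is $B_{n,k}(x)=\sum \frac{n!}{j_1!\cdots j_n!}\prod_{i=1}^n (x_i/i!)^{j_i}$, summed over nonnegative integers with $\sum_i j_i=k$, $\sum_i i j_i=n$. The partial ordinary Bell polynomial is $\hat{B}_{n,k}(x)=\frac{k!}{n!}B_{n,k}(\tilde x)$ with $\tilde x_m=m!\,x_m$. Algorithm 1: 1. Set $y_i\gets x_i/i!$ for $i=1,\ldots,n-k+1$. 2. Initiate $\hat{B}_{0,0}(y)=1$ and $\hat{B}_{i,0}(y)=0$ for $i=1,\ldots,n-k$. 3. For $l=1,\ldots,k$ do: for $i=l,l+1,\ldots,n-k+l$ do: $\hat{B}_{i,l}(y)\gets\sum_{j=1}^{i-l+1}y_j\,\hat{B}_{i-j,l-1}(y)$. 4. Set $B_{n,k}(x)\gets (n!/k!)\,\hat{B}_{n,k}(y)$. Counting convention: the basic arithmetic operations are additions, multiplications and divisions. The factorials $2!,\ldots,n!$ are computed once by successive multiplication ($n-1$ multiplications; $k!$ is among them), step 1 then uses one division per entry ($n-k+1$ divisions), and step 4 uses one division and one multiplication. Each sum of $N$ products in step 3 costs $N$ multiplications and $N-1$ additions, i.e. $2N-1$ operations (also when some factors are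 $0$ or $1$). Assignments, initializations, and computations of loop bounds and array indices are free. *)

theory Defs
  imports Complex_Main "HOL-Library.FuncSet" "HOL-Library.State_Monad"
begin

text \<open>The tuple \<open>(j\<^sub>1, \<dots>, j\<^sub>n)\<close> is an extensional function on \<open>{1..n}\<close>, so that each tuple
  is counted once. The index set is finite, since every \<open>j\<^sub>i\<close> is at most \<open>k\<close>.\<close>

definition bell_indices :: "nat \<Rightarrow> nat \<Rightarrow> (nat \<Rightarrow> nat) set" where
  "bell_indices n k =
    {j \<in> {1..n} \<rightarrow>\<^sub>E UNIV. (\<Sum>i=1..n. j i) = k \<and> (\<Sum>i=1..n. i * j i) = n}"

definition partial_bell :: "nat \<Rightarrow> nat \<Rightarrow> (nat \<Rightarrow> real) \<Rightarrow> real" where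
  "partial_bell n k x =
    (\<Sum>j\<in>bell_indices n k.
      fact n / (\<Prod>i=1..n. fact (j i)) * (\<Prod>i=1..n. (x i / fact i) ^ j i))"

lemma finite_bell_indices: "finite (bell_indices n k)"
proof (rule finite_subset)
  show "bell_indices n k \<subseteq> {1..n} \<rightarrow>\<^sub>E {..k}"
  proof
    fix j assume j: "j \<in> bell_indices n k"
    have "j i \<le> k" if "i \<in> {1..n}" for i
      using member_le_sum[OF that, of j] j by (simp add: bell_indices_def)
    then show "j \<in> {1..n} \<rightarrow>\<^sub>E {..k}"
      using j by (auto simp: bell_indices_def PiE_iff)
  qed
qed (simp add: finite_PiE)

text \<open>A computation is a state monad over a counter of arithmetic operations. The counter is
  advanced only by the three operations below; reading and assigning array entries, constants and
  index arithmetic on \<^typ>\<open>nat\<close> are free.\<close>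

type_synonym 'a counted = "(nat, 'a) state"

definition add_op :: "real \<Rightarrow> real \<Rightarrow> real counted" where
  "add_op a b = do { State_Monad.update Suc; State_Monad.return (a + b) }"

definition mul_op :: "real \<Rightarrow> real \<Rightarrow> real counted" where
  "mul_op a b = do { State_Monad.update Suc; State_Monad.return (a * b) }"

definition div_op :: "real \<Rightarrow> real \<Rightarrow> real counted" where
  "div_op a b = do { State_Monad.update Suc; State_Monad.return (a / b) }"

definition result :: "'a counted \<Rightarrow> 'a" where
  "result c = fst (run_state c 0)"

definition operations :: "'a counted \<Rightarrow> nat" where
  "operations c = snd (run_state c 0)"

primrec for_each :: "nat list \<Rightarrow> (nat \<Rightarrow> 's \<Rightarrow> 's counted) \<Rightarrow> 's \<Rightarrow> 's counted" where
  "for_each [] body s = State_Monad.return s"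
| "for_each (i # is) body s = do { s' \<leftarrow> body i s; for_each is body s' }"

text \<open>Arrays are functions; entries that have not been assigned are \<^const>\<open>undefined\<close>.
  Upper loop bounds are exclusive in \<open>[a..<b]\<close>.\<close>

definition compute_factorials :: "nat \<Rightarrow> (nat \<Rightarrow> real) counted" where
  "compute_factorials n =
    for_each [2..<n + 1]
      (\<lambda>m f. do { z \<leftarrow> mul_op (f (m - 1)) (of_nat m); State_Monad.return (f(m := z)) })
      ((\<lambda>_. undefined)(1 := 1))"

definition compute_y :: "nat \<Rightarrow> nat \<Rightarrow> (nat \<Rightarrow> real) \<Rightarrow> (nat \<Rightarrow> real) \<Rightarrow> (nat \<Rightarrow> real) counted" where
  "compute_y n k x f =
    for_each [1..<n - k + 2]
      (\<lambda>i y. do { z \<leftarrow> div_op (x i) (f i); State_Monad.return (y(i := z)) })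
      (\<lambda>_. undefined)"

definition initial_table :: "nat \<Rightarrow> nat \<Rightarrow> nat \<times> nat \<Rightarrow> real" where
  "initial_table n k =
    (\<lambda>(i, l). if l = 0 \<and> i \<le> n - k then if i = 0 then 1 else 0 else undefined)"

text \<open>The sum over \<open>j = 1, \<dots>, i - l + 1\<close> starts from its first product, so that \<open>N\<close> products
  cost \<open>N - 1\<close> additions.\<close>

definition table_entry ::
    "(nat \<Rightarrow> real) \<Rightarrow> nat \<Rightarrow> nat \<Rightarrow> (nat \<times> nat \<Rightarrow> real) \<Rightarrow> real counted" where
  "table_entry y l i b =
    do {
      p \<leftarrow> mul_op (y 1) (b (i - 1, l - 1));
      for_each [2..<i - l + 2]
        (\<lambda>j s. do { q \<leftarrow> mul_op (y j) (b (i - j, l - 1)); add_op s q })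
        p
    }"

definition compute_table ::
    "nat \<Rightarrow> nat \<Rightarrow> (nat \<Rightarrow> real) \<Rightarrow> (nat \<times> nat \<Rightarrow> real) counted" where
  "compute_table n k y =
    for_each [1..<k + 1]
      (\<lambda>l. for_each [l..<n - k + l + 1]
        (\<lambda>i b. do { s \<leftarrow> table_entry y l i b; State_Monad.return (b((i, l) := s)) }))
      (initial_table n k)"

definition bell_algorithm :: "nat \<Rightarrow> nat \<Rightarrow> (nat \<Rightarrow> real) \<Rightarrow> real counted" where
  "bell_algorithm n k x =
    do {
      f \<leftarrow> compute_factorials n;
      y \<leftarrow> compute_y n k x f;
      b \<leftarrow> compute_table n k y;
      c \<leftarrow> div_op (f n) (f k);
      mul_op c (b (n, k))
    }"

end

theory Submission
  imports Defs "HOL-Computational_Algebra.Formal_Power_Series"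
begin

text \<open>Row \<open>l\<close> of the table holds coefficients of \<open>F\<^sup>l\<close>, where \<open>F = \<Sum>\<^sub>i (x\<^sub>i / i!) X\<^sup>i\<close>: the
  recurrence of the algorithm is the Cauchy product \<open>F \<cdot> F\<^sup>l\<^sup>-\<^sup>1\<close> with its vanishing terms removed.
  By the multinomial theorem the coefficient of \<open>X\<^sup>n\<close> in \<open>F\<^sup>k\<close> is \<open>k!/n!\<close> times the Bell polynomial.
  As for the cost, each of the \<open>k\<close> rows takes \<open>1 + 3 + \<dots> + (2 (n - k + 1) - 1) = (n - k + 1)\<^sup>2\<close>
  operations.\<close>

unbundle fps_syntax

section \<open>The multinomial theorem\<close>

text \<open>Multinomial coefficients are integers. This makes \<open>div\<close> exact, both in a
  semiring without division and in the later passage to real quotients.\<close>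

lemma prod_fact_dvd_fact_sum:
  assumes "finite A"
  shows "(\<Prod>i\<in>A. fact (j i)) dvd (fact (\<Sum>i\<in>A. j i) :: nat)"
  using assms
proof (induction A rule: finite_induct)
  case (insert a A)
  have "fact (j a) * (\<Prod>i\<in>A. fact (j i)) dvd (fact (j a) * fact (\<Sum>i\<in>A. j i) :: nat)"
    using insert.IH by (rule mult_dvd_mono[OF dvd_refl])
  also have "\<dots> dvd fact (j a + (\<Sum>i\<in>A. j i))"
    by (rule fact_fact_dvd_fact)
  finally show ?case
    using insert.hyps by simp
qed simp

text \<open>Peels one part \<open>c\<close> off a multinomial coefficient, leaving a binomial
  factor: the arithmetic behind the induction step of \<open>multinomial_theorem\<close>.\<close>

lemma fact_div_fact_mult:
  assumes "c \<le> k" and "p dvd (fact (k - c) :: nat)"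
  shows "fact k div (fact c * p) = (k choose c) * (fact (k - c) div p)"
proof -
  have "fact k = fact c * (fact (k - c) * (k choose c))"
    using binomial_fact_lemma[OF assms(1)] by (simp add: mult.assoc)
  then have "fact k div (fact c * p) = (fact (k - c) * (k choose c)) div p"
    by simp
  then show ?thesis
    using assms(2) by (simp add: div_mult_swap mult.commute)
qed

definition weak_compositions :: "'b set \<Rightarrow> nat \<Rightarrow> ('b \<Rightarrow> nat) set" where
  "weak_compositions A k = {j \<in> A \<rightarrow>\<^sub>E UNIV. (\<Sum>i\<in>A. j i) = k}"

lemma finite_weak_compositions:
  assumes "finite A"
  shows "finite (weak_compositions A k)"
proof (rule finite_subset)
  show "weak_compositions A k \<subseteq> A \<rightarrow>\<^sub>E {..k}"
    using member_le_sum[OF _ _ assms, of _ j for j :: "'a \<Rightarrow> nat"]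
    by (auto simp: weak_compositions_def PiE_iff extensional_def)
qed (simp add: assms finite_PiE)

lemma sum_weak_compositions_insert:
  assumes "finite A" and "a \<notin> A"
  shows "(\<Sum>j\<in>weak_compositions (insert a A) k. g j) =
    (\<Sum>c\<le>k. \<Sum>j\<in>weak_compositions A (k - c). g (j(a := c)))"
proof -
  have upd: "(\<Sum>i\<in>A. (j(a := c)) i) = (\<Sum>i\<in>A. j i)" for j :: "'a \<Rightarrow> nat" and c
    using assms by (intro sum.cong) auto
  have "(\<Sum>c\<le>k. \<Sum>j\<in>weak_compositions A (k - c). g (j(a := c))) =
      (\<Sum>(c, j)\<in>(SIGMA c:{..k}. weak_compositions A (k - c)). g (j(a := c)))"
    using assms by (intro sum.Sigma) (auto intro: finite_weak_compositions)
  also have "\<dots> = (\<Sum>j\<in>weak_compositions (insert a A) k. g j)"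
  \<comment> \<open>The value at \<open>a\<close> is split off and reset to
    \<open>undefined\<close>, so that the remaining function is extensional on
    \<open>A\<close>.\<close>
  proof (rule sum.reindex_bij_witness[of _ "\<lambda>j. (j a, j(a := undefined))" "\<lambda>(c, j). j(a := c)"],
      goal_cases)
    case (1 p)
    then show ?case
      using assms by (auto simp: weak_compositions_def PiE_iff extensional_def fun_eq_iff)
  next
    case (2 p)
    then show ?case
      using assms upd by (auto simp: weak_compositions_def PiE_iff extensional_def)
  next
    case (3 j)
    then show ?case by simp
  next
    case (4 j)
    then show ?case
      using assms upd by (auto simp: weak_compositions_def PiE_iff extensional_def)
  next
    case (5 p)
    then show ?case by auto
  qed
  finally show ?thesis by simp
qed

text \<open>Induction on \<open>A\<close>: the binomial theorem separates the new summand
  \<open>f a\<close>, and its exponent \<open>c\<close> becomes the value of the tuple at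
  \<open>a\<close>.\<close>

theorem multinomial_theorem:
  fixes f :: "'b \<Rightarrow> 'a::comm_semiring_1"
  assumes "finite A"
  shows "(\<Sum>i\<in>A. f i) ^ k = (\<Sum>j\<in>weak_compositions A k.
    of_nat (fact k div (\<Prod>i\<in>A. fact (j i))) * (\<Prod>i\<in>A. f i ^ j i))"
  using assms
proof (induction A arbitrary: k rule: finite_induct)
  case empty
  then show ?case by (cases k) (simp_all add: weak_compositions_def)
next
  case (insert a A)
  let ?coeff = "\<lambda>B m j. of_nat (fact m div (\<Prod>i\<in>B. fact (j i))) :: 'a"
  have term_eq: "?coeff (insert a A) k (j(a := c)) * (\<Prod>i\<in>insert a A. f i ^ (j(a := c)) i) =
      of_nat (k choose c) * f a ^ c * (?coeff A (k - c) j * (\<Prod>i\<in>A. f i ^ j i))"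
    if c: "c \<le> k" and j: "j \<in> weak_compositions A (k - c)" for c j
  proof -
    have prod_upd: "(\<Prod>i\<in>A. h i ((j(a := c)) i)) = (\<Prod>i\<in>A. h i (j i))"
      for h :: "'b \<Rightarrow> nat \<Rightarrow> 'c::comm_monoid_mult"
      using insert.hyps by (intro prod.cong) auto
    have "(\<Prod>i\<in>A. fact (j i)) dvd (fact (k - c) :: nat)"
      using prod_fact_dvd_fact_sum[OF insert.hyps(1), of j] j
      by (simp add: weak_compositions_def)
    from fact_div_fact_mult[OF c this]
    show ?thesis
      using insert.hyps prod_upd[of "\<lambda>_. fact :: nat \<Rightarrow> nat"] prod_upd[of "\<lambda>i m. f i ^ m"]
      by (simp add: algebra_simps del: fun_upd_apply) (simp add: algebra_simps)
  qed
  have "(\<Sum>i\<in>insert a A. f i) ^ k =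
      (\<Sum>c\<le>k. of_nat (k choose c) * f a ^ c * (\<Sum>i\<in>A. f i) ^ (k - c))"
    using insert.hyps by (simp add: binomial_ring)
  also have "\<dots> = (\<Sum>c\<le>k. \<Sum>j\<in>weak_compositions A (k - c).
      ?coeff (insert a A) k (j(a := c)) * (\<Prod>i\<in>insert a A. f i ^ (j(a := c)) i))"
    by (intro sum.cong refl) (simp add: insert.IH sum_distrib_left term_eq del: fun_upd_apply)
  also have "\<dots> = (\<Sum>j\<in>weak_compositions (insert a A) k.
      ?coeff (insert a A) k j * (\<Prod>i\<in>insert a A. f i ^ j i))"
    using insert.hyps by (rule sum_weak_compositions_insert[symmetric])
  finally show ?case .
qed

section \<open>Bell polynomials as coefficients of powers\<close>

lemma prod_fps_const_X_power_nth:
  fixes y :: "'b \<Rightarrow> 'a::comm_ring_1"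
  assumes "finite A"
  shows "(\<Prod>i\<in>A. (fps_const (y i) * fps_X ^ d i) ^ j i) $ n =
    (if (\<Sum>i\<in>A. d i * j i) = n then \<Prod>i\<in>A. y i ^ j i else 0)"
proof -
  have "(\<Prod>i\<in>A. (fps_const (y i) * fps_X ^ d i) ^ j i) =
      fps_const (\<Prod>i\<in>A. y i ^ j i) * fps_X ^ (\<Sum>i\<in>A. d i * j i)"
    using assms
    by (induction A rule: finite_induct)
      (simp_all add: power_mult_distrib power_add power_mult fps_const_power algebra_simps
        flip: fps_const_mult)
  then show ?thesis
    by (auto simp: fps_X_power_iff)
qed

text \<open>Each tuple of the multinomial expansion contributes a single monomial, of degree
  \<open>\<Sum>i=1..n. i * j i\<close>. Taking the coefficient of degree \<open>n\<close> therefore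
  leaves the tuples in \<open>bell_indices n k\<close>.\<close>

lemma partial_bell_eq_power_nth:
  "partial_bell n k x =
    fact n / fact k * ((\<Sum>i=1..n. fps_const (x i / fact i) * fps_X ^ i) ^ k) $ n"
proof -
  have coeff: "real (fact k div (\<Prod>i=1..n. fact (j i))) = fact k / (\<Prod>i=1..n. fact (j i))"
    if "j \<in> weak_compositions {1..n} k" for j
    using prod_fact_dvd_fact_sum[of "{1..n}" j] that
    by (simp add: weak_compositions_def real_of_nat_div)
  have index_set: "bell_indices n k = {j \<in> weak_compositions {1..n} k. (\<Sum>i=1..n. i * j i) = n}"
    by (auto simp: bell_indices_def weak_compositions_def)
  have "((\<Sum>i=1..n. fps_const (x i / fact i) * fps_X ^ i) ^ k) $ n =
      (\<Sum>j\<in>weak_compositions {1..n} k. real (fact k div (\<Prod>i=1..n. fact (j i))) *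
        (if (\<Sum>i=1..n. i * j i) = n then \<Prod>i=1..n. (x i / fact i) ^ j i else 0))"
    unfolding multinomial_theorem[OF finite_atLeastAtMost] fps_sum_nth fps_mult_of_nat_nth
      prod_fps_const_X_power_nth[OF finite_atLeastAtMost] ..
  also have "\<dots> = (\<Sum>j\<in>bell_indices n k.
      fact k / (\<Prod>i=1..n. fact (j i)) * (\<Prod>i=1..n. (x i / fact i) ^ j i))"
    unfolding index_set
    by (rule sum.mono_neutral_cong_right) (auto simp: finite_weak_compositions coeff simp del: One_nat_def)
  finally show ?thesis
    by (simp add: partial_bell_def sum_distrib_left mult.assoc)
qed

lemma fps_power_Suc_nth_startsby_zero:
  fixes F :: "'a::comm_ring_1 fps"
  assumes "F $ 0 = 0"
  shows "(F ^ Suc l) $ i = (\<Sum>j=1..i - l. F $ j * (F ^ l) $ (i - j))"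
proof -
  have "(F ^ Suc l) $ i = (\<Sum>j=0..i. F $ j * (F ^ l) $ (i - j))"
    by (simp add: fps_mult_nth)
  also have "\<dots> = (\<Sum>j=1..i - l. F $ j * (F ^ l) $ (i - j))"
  proof (rule sum.mono_neutral_right)
    \<comment> \<open>\<open>F ^ l\<close> has no terms below degree \<open>l\<close>. For
      \<open>i < l\<close> truncated subtraction empties the range \<open>{1..i - l}\<close>, and
      every term vanishes.\<close>
    show "\<forall>j\<in>{0..i} - {1..i - l}. F $ j * (F ^ l) $ (i - j) = 0"
    proof
      fix j assume "j \<in> {0..i} - {1..i - l}"
      then have "j = 0 \<or> i - j < l" by auto
      then show "F $ j * (F ^ l) $ (i - j) = 0"
        using assms startsby_zero_power_prefix[OF assms] by auto
    qed
  qed auto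
  finally show ?thesis .
qed

section \<open>Running the algorithm\<close>

lemma run_state_operations [simp]:
  "run_state (add_op a b) t = (a + b, Suc t)"
  "run_state (mul_op a b) t = (a * b, Suc t)"
  "run_state (div_op a b) t = (a / b, Suc t)"
  by (simp_all add: add_op_def mul_op_def div_op_def State_Monad.update_def)

text \<open>Separates values from costs: \<open>cost i\<close> may depend on the index but not on
  the state \<open>s\<close>, so the total is independent of the data.\<close>

lemma run_state_for_each:
  assumes "\<And>i s t. i \<in> set is \<Longrightarrow> run_state (body i s) t = (step i s, t + cost i)"
  shows "run_state (for_each is body s) t = (fold step is s, t + sum_list (map cost is))"
  using assms by (induction "is" arbitrary: s t) simp_all

lemma fold_upd_apply:
  "fold (\<lambda>i y. y(i := g i)) is y j = (if j \<in> set is then g j else y j)"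
  by (induction "is" arbitrary: y) auto

lemma fold_factorial_apply:
  assumes "1 \<le> i" and "i \<le> n"
  shows "fold (\<lambda>m f. f(m := f (m - 1) * real m)) [2..<n + 1] (u(1 := 1)) i = fact i"
  using assms
proof (induction n arbitrary: i)
  case (Suc n)
  show ?case
  \<comment> \<open>For \<open>n = 0\<close> the list \<open>[2..<Suc n + 1]\<close> is empty, and
    no last index can be split off.\<close>
  proof (cases "n = 0")
    case True
    then show ?thesis using Suc.prems by simp
  next
    case False
    then have "[2..<Suc n + 1] = [2..<n + 1] @ [Suc n]" by simp
    then show ?thesis
      using False Suc by (auto simp: le_Suc_eq simp del: upt_Suc)
  qed
qed simp

lemma run_state_compute_factorials:
  obtains f where "run_state (compute_factorials n) t = (f, t + (n - 1))"
    and "\<And>i. 1 \<le> i \<Longrightarrow> i \<le> n \<Longrightarrow> f i = fact i"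
proof
  show "run_state (compute_factorials n) t =
      (fold (\<lambda>m f. f(m := f (m - 1) * real m)) [2..<n + 1] ((\<lambda>_. undefined)(1 := 1)), t + (n - 1))"
    unfolding compute_factorials_def
    by (subst run_state_for_each[where step = "\<lambda>m f. f(m := f (m - 1) * real m)" and cost = "\<lambda>_. 1"])
      (auto simp: sum_list_triv simp del: upt_Suc)
qed (rule fold_factorial_apply)

lemma run_state_compute_y:
  "run_state (compute_y n k x f) t =
    (\<lambda>i. if i \<in> {1..n - k + 1} then x i / f i else undefined, t + (n - k + 1))"
  unfolding compute_y_def
  by (subst run_state_for_each[where step = "\<lambda>i y. y(i := x i / f i)" and cost = "\<lambda>_. 1"])
    (auto simp: sum_list_triv fold_upd_apply fun_eq_iff)

definition entry_sum :: "(nat \<Rightarrow> real) \<Rightarrow> nat \<Rightarrow> nat \<Rightarrow> (nat \<times> nat \<Rightarrow> real) \<Rightarrow> real" where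
  "entry_sum y l i b = (\<Sum>j=1..i - l + 1. y j * b (i - j, l - 1))"

lemma fold_add_eq_sum_upt:
  "fold (\<lambda>j s. s + g j) [m..<n] s = s + sum g {m..<n}" for s :: "'a::comm_monoid_add"
proof (cases "m \<le> n")
  case True
  then show ?thesis
    by (induction n rule: dec_induct) (simp_all add: add.assoc)
qed simp

lemma run_state_table_entry:
  "run_state (table_entry y l i b) t = (entry_sum y l i b, t + (2 * (i - l) + 1))"
proof -
  \<comment> \<open>The first product precedes the loop and costs one operation; each of the
    \<open>i - l\<close> remaining indices costs two.\<close>
  have "{1..i - l + 1} = insert 1 {2..<i - l + 2}" by auto
  then have "entry_sum y l i b = y 1 * b (i - 1, l - 1) +
      (\<Sum>j\<in>{2..<i - l + 2}. y j * b (i - j, l - 1))"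
    by (simp add: entry_sum_def)
  then show ?thesis
    unfolding table_entry_def run_state_bind run_state_operations prod.case
    by (subst run_state_for_each[where step = "\<lambda>j s. s + y j * b (i - j, l - 1)" and cost = "\<lambda>_. 2"])
      (simp_all add: sum_list_triv fold_add_eq_sum_upt del: upt_Suc sum.op_ivl_Suc)
qed

text \<open>Row \<open>l\<close> reads only row \<open>l - 1\<close>, a different row because
  \<open>1 \<le> l\<close>. Updates within the row thus do not interfere, and every entry can be
  evaluated in the table \<open>b\<close> from before the row.\<close>

lemma fold_row_apply:
  assumes "1 \<le> l"
  shows "fold (\<lambda>i b. b((i, l) := entry_sum y l i b)) is b (i', l') =
    (if l' = l \<and> i' \<in> set is then entry_sum y l i' b else b (i', l'))"
proof (induction "is" arbitrary: b)
  case (Cons i "is")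
  have "entry_sum y l i'' (b((i, l) := z)) = entry_sum y l i'' b" for i'' z
  proof -
    have "l - 1 \<noteq> l" using assms by simp
    then show ?thesis by (simp add: entry_sum_def del: One_nat_def)
  qed
  then show ?case
    using Cons by (auto simp del: fun_upd_apply) auto
qed simp

definition table_rows :: "nat \<Rightarrow> nat \<Rightarrow> (nat \<Rightarrow> real) \<Rightarrow> nat \<Rightarrow> nat \<times> nat \<Rightarrow> real" where
  "table_rows n k y r =
    fold (\<lambda>l. fold (\<lambda>i b. b((i, l) := entry_sum y l i b)) [l..<n - k + l + 1]) [1..<r + 1]
      (initial_table n k)"

lemma table_rows_Suc:
  "table_rows n k y (Suc r) =
    fold (\<lambda>i b. b((i, Suc r) := entry_sum y (Suc r) i b)) [Suc r..<n - k + Suc r + 1]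
      (table_rows n k y r)"
proof -
  have "[1..<Suc r + 1] = [1..<r + 1] @ [Suc r]" by simp
  then show ?thesis
    unfolding table_rows_def by (simp only: fold_append fold_simps o_apply)
qed

lemma sum_list_odd: "(\<Sum>i\<leftarrow>[l..<l + m]. 2 * (i - l) + 1) = m ^ 2" for l m :: nat
  by (induction m) (simp_all add: power2_eq_square)

lemma run_state_compute_table:
  "run_state (compute_table n k y) t = (table_rows n k y k, t + k * (n - k + 1) ^ 2)"
proof -
  have row: "run_state (for_each [l..<n - k + l + 1]
        (\<lambda>i b. do { s \<leftarrow> table_entry y l i b; State_Monad.return (b((i, l) := s)) }) b) t =
      (fold (\<lambda>i b. b((i, l) := entry_sum y l i b)) [l..<n - k + l + 1] b, t + (n - k + 1) ^ 2)"
    for l b t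
    by (subst run_state_for_each[where step = "\<lambda>i b. b((i, l) := entry_sum y l i b)"
          and cost = "\<lambda>i. 2 * (i - l) + 1"])
      (use sum_list_odd[of l "n - k + 1"] in \<open>simp_all add: run_state_table_entry ac_simps\<close>)
  show ?thesis
    unfolding compute_table_def table_rows_def
    by (subst run_state_for_each[OF row]) (simp add: sum_list_triv)
qed

text \<open>Induction on the row. Entry \<open>i\<close> of row \<open>Suc r\<close> reads row
  \<open>r\<close> at indices from \<open>r\<close> to \<open>i - 1 \<le> n - k + r\<close>, all
  inside the band already filled, so no unassigned entry is used.\<close>

lemma table_rows_apply:
  fixes F :: "real fps"
  assumes "F $ 0 = 0" and "\<And>j. 1 \<le> j \<Longrightarrow> j \<le> n - k + 1 \<Longrightarrow> y j = F $ j"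
    and "r \<le> i" and "i \<le> n - k + r"
  shows "table_rows n k y r (i, r) = (F ^ r) $ i"
  using assms(3,4)
proof (induction r arbitrary: i)
  case 0
  then show ?case by (simp add: table_rows_def initial_table_def)
next
  case (Suc r)
  have "table_rows n k y (Suc r) (i, Suc r) = entry_sum y (Suc r) i (table_rows n k y r)"
    using Suc.prems fold_row_apply[of "Suc r" y] by (simp add: table_rows_Suc del: upt_Suc)
  also have "\<dots> = (\<Sum>j=1..i - r. F $ j * (F ^ r) $ (i - j))"
    unfolding entry_sum_def using Suc assms(2) by (intro sum.cong) auto
  also have "\<dots> = (F ^ Suc r) $ i"
    by (rule fps_power_Suc_nth_startsby_zero[OF assms(1), symmetric])
  finally show ?case .
qed

theorem proposition1:
  fixes n k :: nat and x :: "nat \<Rightarrow> real"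
  assumes "1 \<le> k" and "k \<le> n"
  shows "result (bell_algorithm n k x) = partial_bell n k x \<and>
    int (operations (bell_algorithm n k x)) =
      int k * int n ^ 2 + 2 * (- (int k ^ 2) + int k + 1) * int n + int k ^ 3 - 2 * int k ^ 2 + 2"
proof -
  obtain f where f: "run_state (compute_factorials n) 0 = (f, 0 + (n - 1))"
    and fact: "\<And>i. 1 \<le> i \<Longrightarrow> i \<le> n \<Longrightarrow> f i = fact i"
    by (rule run_state_compute_factorials) blast
  define y where "y = (\<lambda>i. if i \<in> {1..n - k + 1} then x i / f i else undefined)"
  \<comment> \<open>The final \<open>2\<close> counts the closing division and
    multiplication.\<close>
  have run: "run_state (bell_algorithm n k x) 0 =
      (f n / f k * table_rows n k y k (n, k), n - 1 + (n - k + 1) + k * (n - k + 1) ^ 2 + 2)"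
    unfolding bell_algorithm_def run_state_bind f prod.case run_state_compute_y y_def[symmetric]
    by (simp add: run_state_compute_table)
  \<comment> \<open>\<open>F\<close> extends to degree \<open>n\<close> to match
    \<open>partial_bell_eq_power_nth\<close>; \<open>y\<close> holds only its coefficients up to
    \<open>n - k + 1\<close>, which suffice for \<open>(F ^ k) $ n\<close>.\<close>
  define F where "F = (\<Sum>i=1..n. fps_const (x i / fact i) * fps_X ^ i)"
  have F_nth: "F $ j = (if j \<in> {1..n} then x j / fact j else 0)" for j
    by (simp add: F_def fps_sum_nth fps_X_power_iff if_distrib cong: if_cong)
  have "table_rows n k y k (n, k) = (F ^ k) $ n"
    using assms fact by (intro table_rows_apply) (auto simp: F_nth y_def)
  then have "result (bell_algorithm n k x) = partial_bell n k x"
    using assms fact by (simp add: result_def run partial_bell_eq_power_nth F_def)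
  \<comment> \<open>By \<open>1 \<le> k\<close> and \<open>k \<le> n\<close> the truncated
    subtractions are exact, and a polynomial identity over the integers remains.\<close>
  moreover have "int (operations (bell_algorithm n k x)) =
      int n - 1 + (int n - int k + 1) + int k * (int n - int k + 1) ^ 2 + 2"
    using assms by (simp add: operations_def run of_nat_diff)
  ultimately show ?thesis
    by (simp add: power2_eq_square power3_eq_cube algebra_simps)
qed

end
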